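(* Let $\mathcal G$ be a compact, connected, finite metric graph with edge set $\mathsf E$ and edge lengths $(\ell_{\mathsf e})_{\mathsf e\in\mathsf E}$, and let $\emptyset\ne\mathsf V_{\mathrm D}\subset\mathsf V$ be its set of Dirichlet vertices. Let $\mathsf G$ be the underlying weighted combinatorial graph. Then the torsional rigidity $T(\mathcal G)$ of $\mathcal G$ and the discrete torsional rigidity $T(\mathsf G)$ of $\mathsf G$ are related via \[ T(\mathcal G)=\sum_{\mathsf e\in\mathsf E}\frac{\ell_{\mathsf e}^3}{12}+\frac14\,T(\mathsf G). \]
   Context: A compact, connected, finite metric graph $\mathcal G$ consists of finitely many edges $\mathsf e\simeq[0,\ell_{\mathsf e}]$, $0<\ell_{\mathsf e}<\infty$, glued at their endpoints (the vertices, $\mathsf V$) to form a connected space; loops and multiple edges are allowed. $\mathsf E_{\mathsf v}$ is the set of edges incident to $\mathsf v$; in sums over $\mathsf E_{\mathsf v}$ a loop at $\mathsf v$ is counted twice. $\mathsf V_{\mathrm N}=\mathsf V\setminus\mathsf V_{\mathrm D}$. Torsion function $v$ of $\mathcal G$: the unique function that is continuous on $\mathcal G$, in $H^2$ on each edge, with $-v_{\mathsf e}''=1$ on each edge, $v=0$ on $\mathsf V_{\mathrm D}$, and $\sum_{\mathsf e\in\mathsf E_{\mathsf v}}\frac{\partial v_{\mathsf e}}{\partial n}(\mathsf v)=0$ for all $\mathsf v\in\mathsf V_{\mathrm N}$. Torsional rigidity: $T(\mathcal G)=\int_{\mathcal G}v\,dx$. Discrete objects: $\mathsf E_{\mathrm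 N}$ is the set of edges both of whose endpoints lie in $\mathsf V_{\mathrm N}$, $\mathsf E_{\mathrm D}=\mathsf E\setminus\mathsf E_{\mathrm N}$. The weights are $m(\mathsf v)=\sum_{\mathsf e\in\mathsf E_{\mathsf v}}\ell_{\mathsf e}$ for $\mathsf v\in\mathsf V_{\mathrm N}$, $\mu(\mathsf e)=1/\ell_{\mathsf e}$ for $\mathsf e\in\mathsf E_{\mathrm N}$, and the potential is $c(\mathsf v)=\sum_{\mathsf e\in\mathsf E_{\mathsf v}\cap\mathsf E_{\mathrm D}}1/\ell_{\mathsf e}$ for $\mathsf v\in\mathsf V_{\mathrm N}$. The operator $\mathcal L$ on functions $f$ on $\mathsf V_{\mathrm N}$ is \[ (\mathcal Lf)(\mathsf v)=\frac1{m(\mathsf v)}\Big[\sum_{\mathsf e=\{\mathsf v,\mathsf w\}\in\mathsf E_{\mathsf v}\cap\mathsf E_{\mathrm N}}\mu(\mathsf e)(f(\mathsf v)-f(\mathsf w))+c(\mathsf v)f(\mathsf v)\Big]; \] it is invertible (self-adjoint and positive definite on $\ell^2_m(\mathsf V_{\mathrm N})$). The discrete torsion function is $g=\mathcal L^{-1}\mathbf 1_{\mathsf V_{\mathrm N}}$ and the discrete torsional rigidity is $T(\mathsf G)=\sum_{\mathsf v\in\mathsf V_{\mathrm N}}m(\mathsf v)g(\mathsf v)$. *)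

theory Defs
  imports "HOL-Analysis.Analysis" "Graph_Theory.Digraph" "Graph_Theory.Digraph_Component"
begin

section \<open>Metric graphs\<close>

text \<open>
  The combinatorial graph is a finite directed multigraph; the arc \<open>e\<close> is the edge identified
  with the interval \<open>[0, len e]\<close>, whose endpoint \<open>0\<close> is glued to \<open>tail G e\<close> and whose endpoint
  \<open>len e\<close> is glued to \<open>head G e\<close>. The orientation only serves to parametrise the edges:
  \<open>Digraph_Component.connected\<close> is connectedness of the underlying undirected graph. The edges
  incident to \<open>w\<close> are those in \<open>out_arcs G w\<close> and those in \<open>in_arcs G w\<close>; a sum over incident edges
  is a sum over the first set plus a sum over the second, so that a loop is counted twice.
\<close>

locale metric_graph = fin_digraph G for G :: "('v, 'e) pre_digraph" (structure) +
  fixes len :: "'e \<Rightarrow> real"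
  assumes connected: "Digraph_Component.connected G"
    and len_pos: "e \<in> arcs G \<Longrightarrow> 0 < len e"

datatype ('v, 'e) point = Vertex 'v | Inner 'e real

definition points :: "('v, 'e) pre_digraph \<Rightarrow> ('e \<Rightarrow> real) \<Rightarrow> ('v, 'e) point set" where
  "points G len = Vertex ` verts G \<union> {Inner e x | e x. e \<in> arcs G \<and> 0 < x \<and> x < len e}"

definition edge_point :: "('v, 'e) pre_digraph \<Rightarrow> ('e \<Rightarrow> real) \<Rightarrow> 'e \<Rightarrow> real \<Rightarrow> ('v, 'e) point" where
  "edge_point G len e x =
     (if x = 0 then Vertex (tail G e) else if x = len e then Vertex (head G e) else Inner e x)"

text \<open>The quotient topology of the disjoint union of the intervals \<open>[0, len e]\<close>.\<close>

definition graph_topology :: "('v, 'e) pre_digraph \<Rightarrow> ('e \<Rightarrow> real) \<Rightarrow> ('v, 'e) point topology" where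
  "graph_topology G len = topology (\<lambda>U. U \<subseteq> points G len \<and>
     (\<forall>e\<in>arcs G. openin (top_of_set {0..len e}) {x \<in> {0..len e}. edge_point G len e x \<in> U}))"

lemma openin_graph_topology:
  "openin (graph_topology G len) U \<longleftrightarrow> U \<subseteq> points G len \<and>
     (\<forall>e\<in>arcs G. openin (top_of_set {0..len e}) {x \<in> {0..len e}. edge_point G len e x \<in> U})"
proof -
  let ?P = "\<lambda>e U. {x \<in> {0..len e}. edge_point G len e x \<in> U}"
  let ?L = "\<lambda>U. U \<subseteq> points G len \<and> (\<forall>e\<in>arcs G. openin (top_of_set {0..len e}) (?P e U))"
  have "istopology ?L"
    unfolding istopology_def
  proof (intro conjI allI impI)
    fix S T assume ST: "?L S" "?L T"
    then show "S \<inter> T \<subseteq> points G len" by blast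
    show "\<forall>e\<in>arcs G. openin (top_of_set {0..len e}) (?P e (S \<inter> T))"
    proof
      fix e assume "e \<in> arcs G"
      with ST have "openin (top_of_set {0..len e}) (?P e S \<inter> ?P e T)" by blast
      moreover have "?P e S \<inter> ?P e T = ?P e (S \<inter> T)" by blast
      ultimately show "openin (top_of_set {0..len e}) (?P e (S \<inter> T))" by simp
    qed
  next
    fix K assume K: "\<forall>S\<in>K. ?L S"
    then show "\<Union>K \<subseteq> points G len" by blast
    show "\<forall>e\<in>arcs G. openin (top_of_set {0..len e}) (?P e (\<Union>K))"
    proof
      fix e assume "e \<in> arcs G"
      with K have "openin (top_of_set {0..len e}) (\<Union>(?P e ` K))" by blast
      moreover have "\<Union>(?P e ` K) = ?P e (\<Union>K)" by blast
      ultimately show "openin (top_of_set {0..len e}) (?P e (\<Union>K))" by simp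
    qed
  qed
  then show ?thesis
    unfolding graph_topology_def by (simp add: topology_inverse')
qed

section \<open>The Sobolev space \<open>H\<^sup>2\<close> of an interval\<close>

definition square_integrable :: "real \<Rightarrow> (real \<Rightarrow> real) \<Rightarrow> bool" where
  "square_integrable l f \<longleftrightarrow> f \<in> borel_measurable (lebesgue_on {0<..<l}) \<and>
     integrable (lebesgue_on {0<..<l}) (\<lambda>x. (f x)\<^sup>2)"

text \<open>Test functions are the continuously differentiable functions with compact support in \<open>(0, l)\<close>.\<close>

definition test_function :: "real \<Rightarrow> (real \<Rightarrow> real) \<Rightarrow> bool" where
  "test_function l \<phi> \<longleftrightarrow> \<phi> C1_differentiable_on UNIV \<and>
     (\<exists>a b. 0 < a \<and> a < b \<and> b < l \<and> (\<forall>x. x \<notin> {a..b} \<longrightarrow> \<phi> x = 0))"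

definition weak_derivative :: "real \<Rightarrow> (real \<Rightarrow> real) \<Rightarrow> (real \<Rightarrow> real) \<Rightarrow> bool" where
  "weak_derivative l f g \<longleftrightarrow> (\<forall>\<phi>. test_function l \<phi> \<longrightarrow>
     (LINT x|lebesgue_on {0<..<l}. f x * deriv \<phi> x) = - (LINT x|lebesgue_on {0<..<l}. g x * \<phi> x))"

text \<open>\<open>f\<close> belongs to \<open>H\<^sup>2(0, l)\<close> and has second weak derivative \<open>h\<close>.\<close>

definition H2_second_derivative :: "real \<Rightarrow> (real \<Rightarrow> real) \<Rightarrow> (real \<Rightarrow> real) \<Rightarrow> bool" where
  "H2_second_derivative l f h \<longleftrightarrow> (\<exists>g. square_integrable l f \<and> square_integrable l g \<and>
     square_integrable l h \<and> weak_derivative l f g \<and> weak_derivative l g h)"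

section \<open>Torsion function and torsional rigidity\<close>

definition on_edge ::
  "('v, 'e) pre_digraph \<Rightarrow> ('e \<Rightarrow> real) \<Rightarrow> (('v, 'e) point \<Rightarrow> real) \<Rightarrow> 'e \<Rightarrow> real \<Rightarrow> real" where
  "on_edge G len u e x = u (edge_point G len e x)"

text \<open>
  Outward normal derivatives at the two ends of an edge. The one-sided derivatives exist if
  \<open>u\<close> is continuous and in \<open>H\<^sup>2\<close> on the edge, since then it is \<open>C\<^sup>1\<close> up to the endpoints.
\<close>

definition normal_derivative_tail ::
  "('v, 'e) pre_digraph \<Rightarrow> ('e \<Rightarrow> real) \<Rightarrow> (('v, 'e) point \<Rightarrow> real) \<Rightarrow> 'e \<Rightarrow> real" where
  "normal_derivative_tail G len u e =
     - vector_derivative (on_edge G len u e) (at 0 within {0..len e})"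

definition normal_derivative_head ::
  "('v, 'e) pre_digraph \<Rightarrow> ('e \<Rightarrow> real) \<Rightarrow> (('v, 'e) point \<Rightarrow> real) \<Rightarrow> 'e \<Rightarrow> real" where
  "normal_derivative_head G len u e =
     vector_derivative (on_edge G len u e) (at (len e) within {0..len e})"

text \<open>
  Functions on the graph are represented by extensional functions, which makes the torsion
  function unique as a HOL function.
\<close>

definition is_torsion_function ::
  "('v, 'e) pre_digraph \<Rightarrow> ('e \<Rightarrow> real) \<Rightarrow> 'v set \<Rightarrow> (('v, 'e) point \<Rightarrow> real) \<Rightarrow> bool" where
  "is_torsion_function G len VD u \<longleftrightarrow>
     u \<in> extensional (points G len) \<and>
     continuous_map (graph_topology G len) euclideanreal u \<and>
     (\<forall>e\<in>arcs G. \<exists>h. H2_second_derivative (len e) (on_edge G len u e) h \<and>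
        (AE x in lebesgue_on {0<..<len e}. - h x = 1)) \<and>
     (\<forall>w\<in>VD. u (Vertex w) = 0) \<and>
     (\<forall>w\<in>verts G - VD. (\<Sum>e\<in>out_arcs G w. normal_derivative_tail G len u e) +
        (\<Sum>e\<in>in_arcs G w. normal_derivative_head G len u e) = 0)"

definition torsion_function ::
  "('v, 'e) pre_digraph \<Rightarrow> ('e \<Rightarrow> real) \<Rightarrow> 'v set \<Rightarrow> ('v, 'e) point \<Rightarrow> real" where
  "torsion_function G len VD = (THE u. is_torsion_function G len VD u)"

definition torsional_rigidity :: "('v, 'e) pre_digraph \<Rightarrow> ('e \<Rightarrow> real) \<Rightarrow> 'v set \<Rightarrow> real" where
  "torsional_rigidity G len VD =
     (\<Sum>e\<in>arcs G. LINT x|lebesgue_on {0..len e}. on_edge G len (torsion_function G len VD) e x)"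

section \<open>The underlying weighted combinatorial graph\<close>

definition E_N :: "('v, 'e) pre_digraph \<Rightarrow> 'v set \<Rightarrow> 'e set" where
  "E_N G VD = {e \<in> arcs G. tail G e \<in> verts G - VD \<and> head G e \<in> verts G - VD}"

definition E_D :: "('v, 'e) pre_digraph \<Rightarrow> 'v set \<Rightarrow> 'e set" where
  "E_D G VD = arcs G - E_N G VD"

definition vertex_weight :: "('v, 'e) pre_digraph \<Rightarrow> ('e \<Rightarrow> real) \<Rightarrow> 'v \<Rightarrow> real" where
  "vertex_weight G len w = (\<Sum>e\<in>out_arcs G w. len e) + (\<Sum>e\<in>in_arcs G w. len e)"

definition edge_weight :: "('e \<Rightarrow> real) \<Rightarrow> 'e \<Rightarrow> real" where
  "edge_weight len e = 1 / len e"

definition potential :: "('v, 'e) pre_digraph \<Rightarrow> ('e \<Rightarrow> real) \<Rightarrow> 'v set \<Rightarrow> 'v \<Rightarrow> real" where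
  "potential G len VD w =
     (\<Sum>e\<in>out_arcs G w \<inter> E_D G VD. 1 / len e) + (\<Sum>e\<in>in_arcs G w \<inter> E_D G VD. 1 / len e)"

text \<open>The space of functions on \<open>V\<^sub>N\<close> is \<open>extensional (verts G - VD)\<close>.\<close>

definition discrete_laplacian ::
  "('v, 'e) pre_digraph \<Rightarrow> ('e \<Rightarrow> real) \<Rightarrow> 'v set \<Rightarrow> ('v \<Rightarrow> real) \<Rightarrow> 'v \<Rightarrow> real" where
  "discrete_laplacian G len VD f = (\<lambda>w\<in>verts G - VD. 1 / vertex_weight G len w *
     ((\<Sum>e\<in>out_arcs G w \<inter> E_N G VD. edge_weight len e * (f w - f (head G e))) +
      (\<Sum>e\<in>in_arcs G w \<inter> E_N G VD. edge_weight len e * (f w - f (tail G e))) +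
      potential G len VD w * f w))"

definition discrete_torsion_function ::
  "('v, 'e) pre_digraph \<Rightarrow> ('e \<Rightarrow> real) \<Rightarrow> 'v set \<Rightarrow> 'v \<Rightarrow> real" where
  "discrete_torsion_function G len VD =
     inv_into (extensional (verts G - VD)) (discrete_laplacian G len VD) (\<lambda>w\<in>verts G - VD. 1)"

definition discrete_torsional_rigidity ::
  "('v, 'e) pre_digraph \<Rightarrow> ('e \<Rightarrow> real) \<Rightarrow> 'v set \<Rightarrow> real" where
  "discrete_torsional_rigidity G len VD =
     (\<Sum>w\<in>verts G - VD. vertex_weight G len w * discrete_torsion_function G len VD w)"

end

theory Submission
  imports Defs "Jordan_Normal_Form.Determinant"
begin

text \<open>
  On an edge of length \<open>l\<close> the torsion function is the parabola with second derivative \<open>-1\<close> that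
  interpolates its two vertex values \<open>a\<close> and \<open>b\<close>. Its outward derivative at the end with value
  \<open>a\<close> is \<open>(a - b) / l - l / 2\<close>, so the Kirchhoff condition says that twice the vertex values solve
  the discrete torsion problem. Its integral is \<open>l (a + b) / 2 + l\<^sup>3 / 12\<close>; summing the first term
  over the edges regroups into half of the \<open>m\<close>-weighted sum of the vertex values. The discrete
  problem is uniquely solvable because the energy of a solution of the homogeneous
  problem vanishes, whence it is constant by connectedness, and zero on the Dirichlet vertices.
  That \<open>H\<^sup>2\<close> solutions are parabolas is the lemma of du Bois-Reymond.
\<close>

section \<open>Weak derivatives on an interval\<close>

lemma integrable_lebesgue_on_continuous:
  fixes f :: "real \<Rightarrow> real"
  assumes "continuous_on {0..l} f"
  shows "integrable (lebesgue_on {0<..<l}) f"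
proof -
  have "f absolutely_integrable_on {0..l}"
    by (rule absolutely_integrable_continuous_real[OF assms])
  then have "f absolutely_integrable_on {0<..<l}"
    by (rule set_integrable_subset) auto
  then show ?thesis
    by (rule absolutely_integrable_imp_integrable) auto
qed

lemma integral_lebesgue_on_continuous:
  fixes f :: "real \<Rightarrow> real"
  assumes "continuous_on {0..l} f"
  shows "(LINT x|lebesgue_on {0<..<l}. f x) = integral {0..l} f"
  using lebesgue_integral_eq_integral[OF integrable_lebesgue_on_continuous[OF assms]]
  by (simp add: integral_open_interval_real)

lemma test_functionD:
  assumes "test_function l \<phi>"
  shows "\<And>x. (\<phi> has_real_derivative deriv \<phi> x) (at x)" "continuous_on UNIV (deriv \<phi>)"
    "continuous_on UNIV \<phi>" "\<phi> 0 = 0" "\<phi> l = 0"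
proof -
  have C1: "\<phi> C1_differentiable_on UNIV" and supp: "\<phi> 0 = 0" "\<phi> l = 0"
    using assms unfolding test_function_def by auto
  then have "\<phi> differentiable at x" for x
    by (meson UNIV_I C1_differentiable_on_eq)
  then show D: "(\<phi> has_real_derivative deriv \<phi> x) (at x)" for x
    by (simp add: DERIV_deriv_iff_real_differentiable)
  \<comment> \<open>\<open>C1_differentiable_on\<close> is characterised through
    \<open>vector_derivative\<close>, \<open>weak_derivative\<close> uses \<open>deriv\<close>; for
    differentiable real functions the two agree.\<close>
  then have vd: "vector_derivative \<phi> (at x) = deriv \<phi> x" for x
    by (simp add: has_real_derivative_iff_has_vector_derivative vector_derivative_at)
  show "continuous_on UNIV (deriv \<phi>)"
    using C1 unfolding C1_differentiable_on_eq vd by (simp add: eta_contract_eq)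
  show "continuous_on UNIV \<phi>"
    using D by (meson DERIV_isCont continuous_at_imp_continuous_on)
  show "\<phi> 0 = 0" "\<phi> l = 0" by (fact supp)+
qed

text \<open>Integration by parts: the boundary terms of \<open>p x * \<phi> x\<close> vanish because
  a test function is zero at \<open>0\<close> and \<open>l\<close>.\<close>

lemma weak_derivative_of_classical:
  fixes p p' :: "real \<Rightarrow> real"
  assumes l: "0 < l"
    and p: "\<And>x. (p has_real_derivative p' x) (at x)"
    and p': "continuous_on UNIV p'"
  shows "weak_derivative l p p'"
  unfolding weak_derivative_def
proof (intro allI impI)
  fix \<phi> assume test: "test_function l \<phi>"
  note \<phi> = test_functionD[OF test]
  have cp: "continuous_on UNIV p"
    using p by (meson DERIV_isCont continuous_at_imp_continuous_on)
  have c1: "continuous_on {0..l} (\<lambda>x. p x * deriv \<phi> x)"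
    and c2: "continuous_on {0..l} (\<lambda>x. p' x * \<phi> x)"
    using \<phi>(2,3) cp p' by (auto intro!: continuous_intros elim: continuous_on_subset)
  have pphi: "((\<lambda>x. p x * \<phi> x) has_real_derivative p x * deriv \<phi> x + p' x * \<phi> x) (at x)" for x
    by (auto intro!: derivative_eq_intros p \<phi>(1))
  have "((\<lambda>x. p x * deriv \<phi> x + p' x * \<phi> x) has_integral p l * \<phi> l - p 0 * \<phi> 0) {0..l}"
    using l
    by (intro fundamental_theorem_of_calculus)
      (auto intro!: DERIV_subset[OF pphi] simp flip: has_real_derivative_iff_has_vector_derivative)
  then have "integral {0..l} (\<lambda>x. p x * deriv \<phi> x + p' x * \<phi> x) = 0"
    using \<phi>(4,5) by (simp add: integral_unique)
  also have "integral {0..l} (\<lambda>x. p x * deriv \<phi> x + p' x * \<phi> x) =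
      integral {0..l} (\<lambda>x. p x * deriv \<phi> x) + integral {0..l} (\<lambda>x. p' x * \<phi> x)"
    by (intro integral_add integrable_continuous_interval c1 c2)
  finally show "(LINT x|lebesgue_on {0<..<l}. p x * deriv \<phi> x) =
      - (LINT x|lebesgue_on {0<..<l}. p' x * \<phi> x)"
    by (simp add: integral_lebesgue_on_continuous c1 c2)
qed

section \<open>Trapezoidal approximation of interval indicators\<close>

text \<open>The distance from \<open>x\<close> to the complement of \<open>{a<..<b}\<close>, scaled
  by \<open>n\<close> and cut off at height 1: a continuous substitute for the indicator, whose
  primitive is not continuously differentiable.\<close>

definition trapezoid :: "real \<Rightarrow> real \<Rightarrow> nat \<Rightarrow> real \<Rightarrow> real" where
  "trapezoid a b n x = min 1 (real n * max 0 (min (x - a) (b - x)))"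

lemma continuous_trapezoid: "continuous_on S (trapezoid a b n)"
  unfolding trapezoid_def by (intro continuous_intros)

lemma trapezoid_bounds: "0 \<le> trapezoid a b n x" "trapezoid a b n x \<le> 1"
  unfolding trapezoid_def by auto

lemma trapezoid_eq_0:
  assumes "x \<notin> {a<..<b}"
  shows "trapezoid a b n x = 0"
proof -
  have "max 0 (min (x - a) (b - x)) = 0" using assms by auto
  then show ?thesis unfolding trapezoid_def by simp
qed

text \<open>At distance \<open>d > 0\<close> from the complement of the interval the value is 1 once
  \<open>n\<close> exceeds \<open>1 / d\<close>; outside the interval it is always 0.\<close>

lemma trapezoid_tendsto: "(\<lambda>n. trapezoid a b n x) \<longlonglongrightarrow> indicator {a<..<b} x"
proof (cases "x \<in> {a<..<b}")
  case True
  define d where "d = min (x - a) (b - x)"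
  have d: "d > 0" using True unfolding d_def by auto
  obtain N where N: "1 / d < real N"
    using reals_Archimedean2 by blast
  have "trapezoid a b n x = 1" if "n \<ge> N" for n
  proof -
    have "1 / d \<le> real n" using N that by linarith
    then have "1 \<le> real n * d" using d by (simp add: field_simps)
    then show ?thesis using d unfolding trapezoid_def d_def[symmetric] by simp
  qed
  then have "eventually (\<lambda>n. trapezoid a b n x = 1) sequentially"
    unfolding eventually_sequentially by blast
  then show ?thesis using True by (simp add: tendsto_eventually)
next
  case False
  then show ?thesis by (simp add: trapezoid_eq_0)
qed

text \<open>Dominated convergence with majorant \<open>\<bar>k x\<bar>\<close>, since trapezoids lie
  between 0 and 1.\<close>

lemma tendsto_integral_trapezoid:
  fixes k :: "real \<Rightarrow> real"
  assumes k: "integrable (lebesgue_on {0<..<l}) k"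
  shows "(\<lambda>n. LINT x|lebesgue_on {0<..<l}. k x * trapezoid a b n x)
    \<longlonglongrightarrow> (LINT x|lebesgue_on {0<..<l}. k x * indicator {a<..<b} x)"
proof (rule integral_dominated_convergence[where w = "\<lambda>x. \<bar>k x\<bar>"])
  have m: "k \<in> borel_measurable (lebesgue_on {0<..<l})" using k by auto
  show "(\<lambda>x. k x * indicator {a<..<b} x) \<in> borel_measurable (lebesgue_on {0<..<l})"
    by (intro borel_measurable_times m borel_measurable_indicator')
      (auto simp: sets_restrict_space_iff)
  have "trapezoid a b n \<in> borel_measurable (lebesgue_on {0<..<l})" for n
    by (intro continuous_imp_measurable_on_sets_lebesgue continuous_trapezoid) auto
  then show "(\<lambda>x. k x * trapezoid a b n x) \<in> borel_measurable (lebesgue_on {0<..<l})" for n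
    using m by (intro borel_measurable_times) auto
  show "integrable (lebesgue_on {0<..<l}) (\<lambda>x. \<bar>k x\<bar>)" using k by simp
  show "AE x in lebesgue_on {0<..<l}.
      (\<lambda>n. k x * trapezoid a b n x) \<longlonglongrightarrow> k x * indicator {a<..<b} x"
    by (intro AE_I2 tendsto_mult tendsto_const trapezoid_tendsto)
  show "AE x in lebesgue_on {0<..<l}. norm (k x * trapezoid a b n x) \<le> \<bar>k x\<bar>" for n
    by (rule AE_I2) (auto simp: abs_mult trapezoid_bounds intro: mult_left_le)
qed

section \<open>The lemma of du Bois-Reymond\<close>

text \<open>A continuous function with compact support is the derivative of a test function as soon as
  its integral vanishes.\<close>

lemma orthogonal_to_mean_zero:
  assumes weak: "weak_derivative l k (\<lambda>x. 0)"
    and ab: "0 < a" "a < b" "b < l"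
    and cont: "continuous_on UNIV \<psi>"
    and supp: "\<And>x. x \<notin> {a..b} \<Longrightarrow> \<psi> x = 0"
    and mean: "integral {0..l} \<psi> = 0"
  shows "(LINT x|lebesgue_on {0<..<l}. k x * \<psi> x) = 0"
proof -
  \<comment> \<open>Infinite endpoints give a primitive on the whole line, with two-sided
    derivatives everywhere.\<close>
  have "\<exists>F. \<forall>x. (- \<infinity>) < ereal x \<longrightarrow> ereal x < \<infinity> \<longrightarrow> (F has_vector_derivative \<psi> x) (at x)"
    using cont by (intro einterval_antiderivative) (auto simp: continuous_on_eq_continuous_at)
  then obtain F where F: "\<And>x. (F has_real_derivative \<psi> x) (at x)"
    by (auto simp: has_real_derivative_iff_has_vector_derivative)
  have F0: "(F has_real_derivative 0) (at x)" if "x < a \<or> b < x" for x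
    using F[of x] supp[of x] that by auto
  have left: "F x = F a" if "x \<le> a" for x
  proof (cases "x = a")
    case False
    have "continuous_on {x..a} F"
      using F by (auto intro: continuous_at_imp_continuous_on DERIV_isCont)
    then show ?thesis
      using DERIV_isconst_end[of x a F] F0 False that by simp
  qed simp
  have right: "F x = F b" if "x \<ge> b" for x
  proof (cases "x = b")
    case False
    have "continuous_on {b..x} F"
      using F by (auto intro: continuous_at_imp_continuous_on DERIV_isCont)
    then show ?thesis
      using DERIV_isconst_end[of b x F] F0 False that by simp
  qed simp
  have "(\<psi> has_integral F l - F 0) {0..l}"
    using F ab unfolding has_real_derivative_iff_has_vector_derivative
    by (intro fundamental_theorem_of_calculus) (auto intro: has_vector_derivative_at_within)
  then have "integral {0..l} \<psi> = F l - F 0"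
    by (rule integral_unique)
  \<comment> \<open>The zero mean identifies the constant values of \<open>F\<close> left of
    \<open>a\<close> and right of \<open>b\<close>, so that \<open>F - F a\<close> has support in
    \<open>{a..b}\<close>.\<close>
  then have Fab: "F b = F a"
    using mean left[of 0] right[of l] ab by simp
  define \<phi> where "\<phi> = (\<lambda>x. F x - F a)"
  have D: "(\<phi> has_real_derivative \<psi> x) (at x)" for x
    unfolding \<phi>_def by (auto intro!: derivative_eq_intros F)
  have "\<phi> C1_differentiable_on UNIV"
    unfolding C1_differentiable_on_def
    using D cont by (auto simp: has_real_derivative_iff_has_vector_derivative)
  moreover have "\<phi> x = 0" if "x \<notin> {a..b}" for x
    using left[of x] right[of x] that Fab unfolding \<phi>_def by auto
  ultimately have "test_function l \<phi>"
    unfolding test_function_def using ab by blast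
  moreover have "deriv \<phi> = \<psi>"
    using D by (intro ext DERIV_imp_deriv)
  ultimately show ?thesis
    using weak unfolding weak_derivative_def by fastforce
qed

text \<open>Two trapezoids, each weighted with the integral of the other, have a difference of mean
  zero, which is orthogonal to \<open>k\<close>. In the limit the averages of \<open>k\<close> over
  both intervals agree. The cross-multiplied form avoids division by the integrals \<open>J\<close>,
  which vanish for \<open>n = 0\<close>.\<close>

lemma weak_derivative_0_interval_averages:
  fixes k :: "real \<Rightarrow> real"
  assumes k: "integrable (lebesgue_on {0<..<l}) k"
    and weak: "weak_derivative l k (\<lambda>x. 0)"
    and ab: "0 < a" "a < b" "b < l" and cd: "0 < c" "c < d" "d < l"
  shows "(d - c) * (LINT x|lebesgue_on {0<..<l}. k x * indicator {a<..<b} x) =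
    (b - a) * (LINT x|lebesgue_on {0<..<l}. k x * indicator {c<..<d} x)"
proof -
  let ?M = "lebesgue_on {0<..<l}"
  define P where "P a b n = (LINT x|?M. k x * trapezoid a b n x)" for a b n
  define J where "J a b n = (LINT x|?M. 1 * trapezoid a b n x)" for a b n
  have J: "J a b n = integral {0..l} (trapezoid a b n)" for a b n
    unfolding J_def by (simp add: integral_lebesgue_on_continuous continuous_trapezoid)
  have int: "integrable ?M (\<lambda>x. k x * trapezoid a b n x)" for a b n
  proof (rule Bochner_Integration.integrable_bound[OF k])
    show "(\<lambda>x. k x * trapezoid a b n x) \<in> borel_measurable ?M"
      using k by (intro borel_measurable_times)
        (auto intro: continuous_imp_measurable_on_sets_lebesgue continuous_trapezoid)
    show "AE x in ?M. norm (k x * trapezoid a b n x) \<le> norm (k x)"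
      by (rule AE_I2) (auto simp: abs_mult trapezoid_bounds intro: mult_left_le)
  qed
  have eq: "J c d n * P a b n = J a b n * P c d n" for n
  proof -
    define \<psi> where "\<psi> x = J c d n * trapezoid a b n x - J a b n * trapezoid c d n x" for x
    have "integral {0..l} \<psi> = J c d n * J a b n - J a b n * J c d n"
      unfolding \<psi>_def J
      by (subst integral_diff)
        (auto intro!: integrable_continuous_interval continuous_intros continuous_trapezoid)
    then have mean: "integral {0..l} \<psi> = 0" by simp
    have cont: "continuous_on UNIV \<psi>"
      unfolding \<psi>_def by (intro continuous_intros continuous_trapezoid)
    \<comment> \<open>One interval containing both supports, still compactly inside
      \<open>{0<..<l}\<close>.\<close>
    have supp: "\<psi> x = 0" if "x \<notin> {min a c..max b d}" for x
    proof -
      have "x \<notin> {a<..<b}" "x \<notin> {c<..<d}" using that by auto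
      then show ?thesis by (simp add: \<psi>_def trapezoid_eq_0)
    qed
    have "(LINT x|?M. k x * \<psi> x) = 0"
      using ab cd
      by (intro orthogonal_to_mean_zero[OF weak _ _ _ cont supp mean]) auto
    also have "(\<lambda>x. k x * \<psi> x) =
        (\<lambda>x. J c d n * (k x * trapezoid a b n x) - J a b n * (k x * trapezoid c d n x))"
      by (auto simp: \<psi>_def algebra_simps)
    finally show ?thesis
      using int by (simp add: P_def)
  qed
  have P: "P a b \<longlonglongrightarrow> (LINT x|?M. k x * indicator {a<..<b} x)" for a b
    unfolding P_def by (rule tendsto_integral_trapezoid[OF k])
  \<comment> \<open>The same convergence for the constant function 1 yields the length of the
    interval.\<close>
  have Jlim: "J a b \<longlonglongrightarrow> b - a" if "0 < a" "a < b" "b < l" for a b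
  proof -
    have "{a<..<b} \<inter> {0<..<l} = {a<..<b}" using that by auto
    moreover have "measure ?M {a<..<b} = b - a"
      using that by (subst measure_restrict_space) auto
    ultimately have "(LINT x|?M. 1 * indicator {a<..<b} x) = b - a"
      by simp
    then show ?thesis
      unfolding J_def
      using tendsto_integral_trapezoid[OF integrable_lebesgue_on_continuous[of l "\<lambda>x. 1"], of a b]
      by simp
  qed
  have "(\<lambda>n. J c d n * P a b n) \<longlonglongrightarrow> (d - c) * (LINT x|?M. k x * indicator {a<..<b} x)"
    by (intro tendsto_mult Jlim P cd)
  moreover have "(\<lambda>n. J c d n * P a b n) \<longlonglongrightarrow> (b - a) * (LINT x|?M. k x * indicator {c<..<d} x)"
    unfolding eq by (intro tendsto_mult Jlim P ab)
  ultimately show ?thesis by (rule LIMSEQ_unique)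
qed

text \<open>The lemma of du Bois-Reymond: all averages over subintervals agree, so the function is
  constant by Lebesgue's differentiation theorem.\<close>

lemma weak_derivative_0_imp_AE_const:
  fixes k :: "real \<Rightarrow> real"
  assumes l: "0 < l" and k: "integrable (lebesgue_on {0<..<l}) k"
    and weak: "weak_derivative l k (\<lambda>x. 0)"
  obtains C where "AE x in lebesgue_on {0<..<l}. k x = C"
proof -
  let ?M = "lebesgue_on {0<..<l}"
  \<comment> \<open>The differentiation theorem concerns functions on the whole line, so
    \<open>k\<close> is extended by zero.\<close>
  define K where "K x = (if x \<in> {0<..<l} then k x else 0)" for x
  \<comment> \<open>The middle third serves as reference interval; \<open>C\<close> is the average
    of \<open>k\<close> over it.\<close>
  define C where "C = (LINT x|?M. k x * indicator {l/3<..<2*l/3} x) / (l/3)"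
  have avg: "(LINT x|?M. k x * indicator {a<..<b} x) = C * (b - a)" if "0 < a" "a < b" "b < l" for a b
    using weak_derivative_0_interval_averages[OF k weak that, of "l/3" "2*l/3"] l
    by (simp add: C_def field_simps)
  have "k integrable_on {0<..<l}"
    using k by (rule integrable_on_lebesgue_on) auto
  then have "K integrable_on UNIV"
    unfolding K_def by (simp only: integrable_restrict_UNIV)
  then have "K integrable_on cbox a b" for a b
    by (rule integrable_on_subcbox) auto
  from integrable_ccontinuous_explicit[of K, OF this] obtain N where N: "negligible N" and
    leb: "\<And>x e. \<lbrakk>x \<notin> N; 0 < e\<rbrakk> \<Longrightarrow> \<exists>d>0. \<forall>h. 0 < h \<and> h < d \<longrightarrow>
        norm (integral (cbox x (x + h *\<^sub>R One)) K /\<^sub>R h ^ DIM(real) - K x) < e"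
    by blast
  have int: "integral {a..b} K = C * (b - a)" if "0 < a" "a < b" "b < l" for a b
  proof -
    have ki: "integrable ?M (\<lambda>x. k x * indicator {a<..<b} x)"
      using that by (intro integrable_real_mult_indicator k) (auto simp: sets_restrict_space_iff)
    have "C * (b - a) = integral {0<..<l} (\<lambda>x. k x * indicator {a<..<b} x)"
      using lebesgue_integral_eq_integral[OF ki] avg[OF that] by simp
    also have "\<dots> = integral UNIV (\<lambda>x. if x \<in> {0<..<l} then k x * indicator {a<..<b} x else 0)"
      by (rule integral_restrict_UNIV[symmetric])
    also have "\<dots> = integral UNIV (\<lambda>x. if x \<in> {a<..<b} then K x else 0)"
      using that by (intro arg_cong[of _ _ "integral UNIV"]) (auto simp: K_def)
    also have "\<dots> = integral {a<..<b} K"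
      by (rule integral_restrict_UNIV)
    finally show ?thesis by (simp add: integral_open_interval_real)
  qed
  have "K x = C" if x: "x \<in> {0<..<l}" "x \<notin> N" for x
  proof (rule ccontr)
    assume "K x \<noteq> C"
    then obtain d where d: "d > 0" "\<And>h. 0 < h \<Longrightarrow> h < d \<Longrightarrow>
        \<bar>integral {x..x + h} K / h - K x\<bar> < \<bar>C - K x\<bar>"
      using leb[OF x(2), of "\<bar>C - K x\<bar>"] by (auto simp: field_simps)
    \<comment> \<open>The second bound keeps \<open>x + h\<close> below \<open>l\<close>. The
      average over \<open>{x..x + h}\<close> is then exactly \<open>C\<close>, which contradicts the
      strict tolerance \<open>\<bar>C - K x\<bar>\<close>.\<close>
    define h where "h = min (d / 2) ((l - x) / 2)"
    have h: "0 < h" "h < d" "x + h < l"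
      using d(1) x(1) unfolding h_def by (auto simp: min_def field_simps)
    show False
      using d(2)[OF h(1,2)] int[of x "x + h"] x(1) h by simp
  qed
  then have "{x \<in> {0<..<l}. k x \<noteq> C} \<subseteq> N"
    by (auto simp: K_def)
  then have "AE x in lebesgue. x \<in> {0<..<l} \<longrightarrow> k x = C"
    using N by (intro AE_I'[of N]) (auto simp: negligible_iff_null_sets)
  then show ?thesis
    using that by (simp add: AE_restrict_space_iff)
qed


section \<open>Regularity of weak solutions with second derivative -1\<close>

text \<open>The interval has finite measure, and the absolute value of \<open>y\<close> is at most 1
  plus the square of \<open>y\<close>.\<close>

lemma square_integrable_imp_integrable:
  assumes "square_integrable l f"
  shows "integrable (lebesgue_on {0<..<l}) f"
proof (rule Bochner_Integration.integrable_bound)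
  show "integrable (lebesgue_on {0<..<l}) (\<lambda>x. 1 + (f x)\<^sup>2)"
    using assms integrable_lebesgue_on_continuous[of l "\<lambda>x. 1"]
    unfolding square_integrable_def by (intro Bochner_Integration.integrable_add) auto
  show "f \<in> borel_measurable (lebesgue_on {0<..<l})"
    using assms unfolding square_integrable_def by simp
  have "\<bar>y\<bar> \<le> \<bar>1 + y\<^sup>2\<bar>" for y :: real
    using sum_power2_ge_zero[of "\<bar>y\<bar> - 1" 0] zero_le_power2[of y]
    by (simp add: power2_diff)
  then show "AE x in lebesgue_on {0<..<l}. norm (f x) \<le> norm (1 + (f x)\<^sup>2)"
    by (intro AE_I2) simp
qed

text \<open>On the compact interval \<open>\<psi>\<close> is bounded by some \<open>B\<close>, so
  \<open>B * \<bar>k x\<bar>\<close> is a majorant. This justifies splitting the integrals in the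
  definition of weak derivatives.\<close>

lemma integrable_mult_continuous:
  fixes k \<psi> :: "real \<Rightarrow> real"
  assumes k: "integrable (lebesgue_on {0<..<l}) k" and \<psi>: "continuous_on UNIV \<psi>"
  shows "integrable (lebesgue_on {0<..<l}) (\<lambda>x. k x * \<psi> x)"
proof -
  have "compact (\<psi> ` {0..l})"
    using \<psi> by (intro compact_continuous_image) (auto elim: continuous_on_subset)
  then obtain B where B: "\<And>x. x \<in> {0..l} \<Longrightarrow> \<bar>\<psi> x\<bar> \<le> B"
    using compact_imp_bounded[of "\<psi> ` {0..l}"] unfolding bounded_iff real_norm_def by blast
  show ?thesis
  proof (rule Bochner_Integration.integrable_bound)
    show "integrable (lebesgue_on {0<..<l}) (\<lambda>x. B * \<bar>k x\<bar>)"
      using k by simp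
    show "(\<lambda>x. k x * \<psi> x) \<in> borel_measurable (lebesgue_on {0<..<l})"
      using k \<psi> by (intro borel_measurable_times)
        (auto intro!: continuous_imp_measurable_on_sets_lebesgue elim: continuous_on_subset)
    have "\<bar>k x\<bar> * \<bar>\<psi> x\<bar> \<le> \<bar>B * \<bar>k x\<bar>\<bar>" if "x \<in> {0<..<l}" for x
      using mult_left_mono[of "\<bar>\<psi> x\<bar>" B "\<bar>k x\<bar>"] B[of x] that by (simp add: mult.commute)
    then show "AE x in lebesgue_on {0<..<l}. norm (k x * \<psi> x) \<le> norm (B * \<bar>k x\<bar>)"
      by (intro AE_I2) (simp add: abs_mult)
  qed
qed

text \<open>By linearity \<open>f - p\<close> has weak derivative 0, so the lemma of du Bois-Reymond
  applies to it.\<close>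

lemma weak_derivative_eq_up_to_const:
  assumes l: "0 < l"
    and int: "integrable (lebesgue_on {0<..<l}) f" "integrable (lebesgue_on {0<..<l}) g"
      "integrable (lebesgue_on {0<..<l}) p" "integrable (lebesgue_on {0<..<l}) q"
    and weak: "weak_derivative l f g" "weak_derivative l p q"
    and eq: "AE x in lebesgue_on {0<..<l}. g x = q x"
  obtains C where "AE x in lebesgue_on {0<..<l}. f x = p x + C"
proof -
  let ?M = "lebesgue_on {0<..<l}"
  have "weak_derivative l (\<lambda>x. f x - p x) (\<lambda>x. 0)"
    unfolding weak_derivative_def
  proof (intro allI impI)
    fix \<phi> assume test: "test_function l \<phi>"
    note \<phi> = test_functionD[OF test]
    note I = integrable_mult_continuous
    have "(LINT x|?M. (f x - p x) * deriv \<phi> x) =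
        (LINT x|?M. f x * deriv \<phi> x) - (LINT x|?M. p x * deriv \<phi> x)"
      using I[OF int(1) \<phi>(2)] I[OF int(3) \<phi>(2)] by (simp add: left_diff_distrib)
    also have "\<dots> = (LINT x|?M. q x * \<phi> x) - (LINT x|?M. g x * \<phi> x)"
      using weak test unfolding weak_derivative_def by simp
    also have "\<dots> = (LINT x|?M. (q x - g x) * \<phi> x)"
      using I[OF int(2) \<phi>(3)] I[OF int(4) \<phi>(3)] by (simp add: left_diff_distrib)
    also have "\<dots> = 0"
      by (rule integral_eq_zero_AE) (use eq in eventually_elim, simp)
    finally show "(LINT x|?M. (f x - p x) * deriv \<phi> x) = - (LINT x|?M. 0 * \<phi> x)"
      by simp
  qed
  then obtain C where C: "AE x in ?M. f x - p x = C"
    using weak_derivative_0_imp_AE_const[OF l Bochner_Integration.integrable_diff[OF int(1,3)]]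
    by blast
  then have "AE x in ?M. f x = p x + C"
    by eventually_elim simp
  then show ?thesis by (rule that)
qed

text \<open>The subset of the open interval where the functions differ is open and negligible, hence
  empty; the endpoints follow by closure.\<close>

lemma continuous_AE_eq_imp_eq:
  fixes f q :: "real \<Rightarrow> real"
  assumes l: "0 < l" and cont: "continuous_on {0..l} f" "continuous_on {0..l} q"
    and eq: "AE x in lebesgue_on {0<..<l}. f x = q x"
    and x: "x \<in> {0..l}"
  shows "f x = q x"
proof -
  define S where "S = {x \<in> {0<..<l}. f x - q x \<in> - {0}}"
  have "continuous_on {0<..<l} (\<lambda>x. f x - q x)"
    using cont by (auto intro!: continuous_intros elim: continuous_on_subset)
  then have "open S"
    unfolding S_def using continuous_open_preimage[of "{0<..<l}" "\<lambda>x. f x - q x" "- {0}"]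
    by (simp add: vimage_def Int_def conj_assoc open_Compl)
  moreover have "negligible S"
  proof -
    have "AE x in lebesgue. x \<notin> S"
      using eq by (auto simp: AE_restrict_space_iff S_def elim: eventually_mono)
    then show ?thesis
      unfolding negligible_iff_null_sets
      using \<open>open S\<close> by (subst AE_iff_null_sets) auto
  qed
  ultimately have "S = {}"
    using open_not_negligible by blast
  then have "f x - q x = 0" if "x \<in> {0<..<l}" for x
    using that unfolding S_def by auto
  moreover have "closure {0<..<l} = {0..l}" using l by simp
  ultimately have "f x - q x = 0"
    using cont x
    by (intro continuous_constant_on_closure[of "{0<..<l}" "\<lambda>x. f x - q x" 0 x])
      (auto intro: continuous_on_diff)
  then show ?thesis by simp
qed

text \<open>Two integrations: comparing the first weak derivative with \<open>- x\<close> yields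
  \<open>c\<close>, then comparing \<open>f\<close> with a primitive of \<open>- x + c\<close>
  yields \<open>A\<close>. Continuity turns the almost everywhere identity into a pointwise
  one.\<close>

lemma H2_minus_one_imp_quadratic:
  assumes l: "0 < l" and cont: "continuous_on {0..l} f"
    and H2: "H2_second_derivative l f h"
    and eq: "AE x in lebesgue_on {0<..<l}. - h x = 1"
  obtains A c where "\<And>x. x \<in> {0..l} \<Longrightarrow> f x = A + c * x - x\<^sup>2 / 2"
proof -
  obtain g where sq: "square_integrable l f" "square_integrable l g" "square_integrable l h"
    and weak: "weak_derivative l f g" "weak_derivative l g h"
    using H2 unfolding H2_second_derivative_def by blast
  note int = sq[THEN square_integrable_imp_integrable]
  note cint = integrable_lebesgue_on_continuous
  have "AE x in lebesgue_on {0<..<l}. h x = - 1"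
    using eq by eventually_elim simp
  moreover have "weak_derivative l (\<lambda>x. - x) (\<lambda>x. - 1)"
    using l by (intro weak_derivative_of_classical) (auto intro!: derivative_eq_intros)
  ultimately obtain c where "AE x in lebesgue_on {0<..<l}. g x = - x + c"
    using weak_derivative_eq_up_to_const[OF l int(2,3) cint cint weak(2), of "\<lambda>x. - x" "\<lambda>x. - 1"]
      continuous_on_minus[OF continuous_on_id, of "{0..l}"]
    by auto
  moreover have "weak_derivative l (\<lambda>x. c * x - x\<^sup>2 / 2) (\<lambda>x. - x + c)"
    using l by (intro weak_derivative_of_classical)
      (auto intro!: derivative_eq_intros continuous_intros)
  moreover have "continuous_on {0..l} (\<lambda>x. c * x - x\<^sup>2 / 2)" "continuous_on {0..l} (\<lambda>x. - x + c)"
    by (auto intro!: continuous_intros)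
  ultimately obtain A where "AE x in lebesgue_on {0<..<l}. f x = c * x - x\<^sup>2 / 2 + A"
    using weak_derivative_eq_up_to_const[OF l int(1,2) cint cint weak(1)] by blast
  then have "f x = c * x - x\<^sup>2 / 2 + A" if "x \<in> {0..l}" for x
    using that by (intro continuous_AE_eq_imp_eq[OF l cont]) (auto intro!: continuous_intros)
  then show ?thesis
    by (intro that[of A c]) (simp add: algebra_simps)
qed

text \<open>The converse direction, for the existence of the torsion function. Only values inside
  \<open>{0<..<l}\<close> matter, so \<open>f\<close> may be replaced by the polynomial
  \<open>p\<close>, which is differentiable on the whole line.\<close>

lemma H2_second_derivative_quadratic:
  assumes l: "0 < l" and f: "\<And>x. x \<in> {0..l} \<Longrightarrow> f x = A + c * x - x\<^sup>2 / 2"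
  shows "H2_second_derivative l f (\<lambda>x. - 1)"
proof -
  define p where "p = (\<lambda>x::real. A + c * x - x\<^sup>2 / 2)"
  have fp: "f x = p x" if "x \<in> {0<..<l}" for x
    using f that unfolding p_def by simp
  have sq: "square_integrable l q" if "continuous_on UNIV q" for q
  proof -
    have "integrable (lebesgue_on {0<..<l}) (\<lambda>x. (q x)\<^sup>2)"
      using that by (intro integrable_lebesgue_on_continuous continuous_intros)
        (auto elim: continuous_on_subset)
    moreover have "q \<in> borel_measurable (lebesgue_on {0<..<l})"
      using that
      by (intro continuous_imp_measurable_on_sets_lebesgue) (auto elim: continuous_on_subset)
    ultimately show ?thesis unfolding square_integrable_def by blast
  qed
  have sq_f: "square_integrable l f \<longleftrightarrow> square_integrable l p"
  proof -
    have "f \<in> borel_measurable (lebesgue_on {0<..<l}) \<longleftrightarrow> p \<in> borel_measurable (lebesgue_on {0<..<l})"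
      using fp by (intro measurable_cong) auto
    moreover have "integrable (lebesgue_on {0<..<l}) (\<lambda>x. (f x)\<^sup>2) \<longleftrightarrow>
        integrable (lebesgue_on {0<..<l}) (\<lambda>x. (p x)\<^sup>2)"
      using fp by (intro Bochner_Integration.integrable_cong) auto
    ultimately show ?thesis unfolding square_integrable_def by simp
  qed
  have weak_f: "weak_derivative l f g \<longleftrightarrow> weak_derivative l p g" for g
  proof -
    have "(LINT x|lebesgue_on {0<..<l}. f x * deriv \<phi> x) =
        (LINT x|lebesgue_on {0<..<l}. p x * deriv \<phi> x)" for \<phi>
      using fp by (intro Bochner_Integration.integral_cong) auto
    then show ?thesis unfolding weak_derivative_def by simp
  qed
  have "weak_derivative l p (\<lambda>x. c - x)"
    unfolding p_def using l by (intro weak_derivative_of_classical)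
      (auto intro!: derivative_eq_intros continuous_intros)
  moreover have "weak_derivative l (\<lambda>x. c - x) (\<lambda>x. - 1)"
    using l by (intro weak_derivative_of_classical) (auto intro!: derivative_eq_intros)
  moreover have "square_integrable l p"
    unfolding p_def by (intro sq continuous_intros) auto
  moreover have "square_integrable l (\<lambda>x. c - x)" "square_integrable l (\<lambda>x. - 1)"
    by (intro sq continuous_intros)+
  ultimately show ?thesis
    unfolding H2_second_derivative_def sq_f weak_f by blast
qed

section \<open>The Dirichlet problem on a weighted graph\<close>

text \<open>In finite dimension a trivial kernel implies surjectivity: after enumerating
  \<open>S\<close> by \<open>h\<close>, the determinant is nonzero and a right inverse
  \<open>B\<close> produces the solution.\<close>

lemma linear_system_solvable:
  fixes M :: "'a \<Rightarrow> 'a \<Rightarrow> 'b :: field"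
  assumes fin: "finite S"
    and inj: "\<And>x. (\<And>i. i \<in> S \<Longrightarrow> (\<Sum>j\<in>S. M i j * x j) = 0) \<Longrightarrow> \<forall>j\<in>S. x j = 0"
  obtains x where "\<And>i. i \<in> S \<Longrightarrow> (\<Sum>j\<in>S. M i j * x j) = b i"
proof -
  define n where "n = card S"
  obtain h where h: "bij_betw h {0..<n} S"
    using ex_bij_betw_nat_finite[OF fin] unfolding n_def by blast
  define k where "k = inv_into {0..<n} h"
  have kh: "k (h j) = j" if "j < n" for j
    using h that unfolding k_def by (simp add: bij_betw_inv_into_left)
  have hk: "h (k i) = i" "k i < n" if "i \<in> S" for i
    using bij_betw_inv_into_right[OF h that] bij_betw_inv_into[OF h] that
    unfolding k_def by (auto dest: bij_betwE)
  define A where "A = mat n n (\<lambda>(i, j). M (h i) (h j))"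
  have A: "A \<in> carrier_mat n n" unfolding A_def by simp
  have prod: "vec_index (A *\<^sub>v v) (k i) = (\<Sum>j\<in>S. M i j * vec_index v (k j))"
    if "v \<in> carrier_vec n" "i \<in> S" for v i
  proof -
    have "vec_index (A *\<^sub>v v) (k i) = (\<Sum>j\<in>{0..<n}. M i (h j) * vec_index v (k (h j)))"
      using that hk by (auto simp: A_def scalar_prod_def kh intro!: sum.cong)
    also have "\<dots> = (\<Sum>j\<in>S. M i j * vec_index v (k j))"
      by (rule sum.reindex_bij_betw[OF h])
    finally show ?thesis .
  qed
  have "Determinant.det A \<noteq> 0"
  proof
    assume "Determinant.det A = 0"
    then obtain v where v: "v \<in> carrier_vec n" "v \<noteq> 0\<^sub>v n" "A *\<^sub>v v = 0\<^sub>v n"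
      using det_0_iff_vec_prod_zero_field[OF A] by blast
    have "\<forall>j\<in>S. vec_index v (k j) = 0"
      using v prod hk by (intro inj) (metis index_zero_vec(1))
    then have "vec_index v j = 0" if "j < n" for j
      using that kh h by (metis atLeastLessThan_iff bij_betwE le0)
    then have "v = 0\<^sub>v n"
      using v(1) by (intro eq_vecI) auto
    with v(2) show False by simp
  qed
  \<comment> \<open>Invertibility is membership in the units of the matrix ring; \<open>()\<close>
    fills the extension slot of the ring record.\<close>
  from det_non_zero_imp_unit[OF A this, of "()"]
  obtain B where B: "B \<in> carrier_mat n n" "A * B = 1\<^sub>m n"
    unfolding Units_def ring_mat_def by auto
  define v where "v = B *\<^sub>v vec n (\<lambda>i. b (h i))"
  have v: "v \<in> carrier_vec n" using B unfolding v_def by simp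
  have "A *\<^sub>v v = vec n (\<lambda>i. b (h i))"
    using A B unfolding v_def by (subst assoc_mult_mat_vec[symmetric]) auto
  then have "(\<Sum>j\<in>S. M i j * vec_index v (k j)) = b i" if "i \<in> S" for i
    using prod[OF v that] hk[OF that] by simp
  then show ?thesis by (rule that)
qed

section \<open>Flows, energy and solvability on the graph\<close>

locale dirichlet_graph = metric_graph +
  fixes VD
  assumes VD_nonempty: "VD \<noteq> {}" and VD_verts: "VD \<subseteq> verts G"
begin

text \<open>Each arc has exactly one tail, so the sets of outgoing arcs partition the arcs.\<close>

lemma sum_out_arcs: "(\<Sum>w\<in>verts G. \<Sum>e\<in>out_arcs G w. \<phi> e) = (\<Sum>e\<in>arcs G. \<phi> e)"
proof -
  have "(\<Sum>w\<in>verts G. \<Sum>e\<in>{e \<in> arcs G. tail G e = w}. \<phi> e) = (\<Sum>e\<in>arcs G. \<phi> e)"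
    by (rule sum.group) auto
  then show ?thesis by (simp add: out_arcs_def)
qed

lemma sum_in_arcs: "(\<Sum>w\<in>verts G. \<Sum>e\<in>in_arcs G w. \<phi> e) = (\<Sum>e\<in>arcs G. \<phi> e)"
proof -
  have "(\<Sum>w\<in>verts G. \<Sum>e\<in>{e \<in> arcs G. head G e = w}. \<phi> e) = (\<Sum>e\<in>arcs G. \<phi> e)"
    by (rule sum.group) auto
  then show ?thesis by (simp add: in_arcs_def)
qed

text \<open>Connectedness gives a walk in the symmetrised graph; the equality propagates along it,
  whichever way an arc is traversed.\<close>

lemma const_if_const_on_arcs:
  assumes eq: "\<And>e. e \<in> arcs G \<Longrightarrow> f (tail G e) = f (head G e)"
    and "u \<in> verts G" "w \<in> verts G"
  shows "f u = f w"
proof -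
  interpret S: pair_wf_digraph "mk_symmetric G"
    by (rule wellformed_mk_symmetric)
  have "u \<rightarrow>\<^sup>*\<^bsub>with_proj (mk_symmetric G)\<^esub> w"
    using connected assms(2,3)
    unfolding Digraph_Component.connected_def strongly_connected_def by simp
  then show ?thesis
  proof (induction rule: S.reachable_induct)
    case base
    show ?case by simp
  next
    case (step x y)
    then show ?case using eq by (auto simp: parcs_mk_symmetric)
  qed
qed

text \<open>Connectedness to a Dirichlet vertex, which differs from \<open>w\<close>, forces an edge
  at \<open>w\<close>.\<close>

lemma vertex_weight_pos:
  assumes "w \<in> verts G - VD"
  shows "0 < vertex_weight G len w"
proof -
  have pos: "0 \<le> (\<Sum>e\<in>out_arcs G w. len e)" "0 \<le> (\<Sum>e\<in>in_arcs G w. len e)"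
    by (intro sum_nonneg less_imp_le len_pos; simp)+
  have "out_arcs G w \<noteq> {} \<or> in_arcs G w \<noteq> {}"
  proof (rule ccontr)
    assume "\<not> ?thesis"
    \<comment> \<open>If \<open>w\<close> were isolated, the truth value of \<open>x = w\<close>
      would be constant along arcs, hence on all vertices.\<close>
    then have "(tail G e = w) = (head G e = w)" if "e \<in> arcs G" for e
      using that by auto
    moreover obtain u where "u \<in> VD" using VD_nonempty by blast
    ultimately show False
      using const_if_const_on_arcs[of "\<lambda>x. x = w" u w] assms VD_verts by blast
  qed
  then show ?thesis
  proof
    assume "out_arcs G w \<noteq> {}"
    then have "0 < (\<Sum>e\<in>out_arcs G w. len e)"
      using len_pos by (intro sum_pos) auto
    then show ?thesis using pos unfolding vertex_weight_def by linarith
  next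
    assume "in_arcs G w \<noteq> {}"
    then have "0 < (\<Sum>e\<in>in_arcs G w. len e)"
      using len_pos by (intro sum_pos) auto
    then show ?thesis using pos unfolding vertex_weight_def by linarith
  qed
qed

text \<open>The unnormalised Laplacian with conductances \<open>1 / len e\<close> on all vertices,
  Dirichlet ones included: the sum of outward slopes at \<open>w\<close> of the edgewise linear
  interpolation of \<open>f\<close>.\<close>

definition flow :: "('a \<Rightarrow> real) \<Rightarrow> 'a \<Rightarrow> real" where
  "flow f w = (\<Sum>e\<in>out_arcs G w. (f w - f (head G e)) / len e) +
    (\<Sum>e\<in>in_arcs G w. (f w - f (tail G e)) / len e)"

lemma flow_sum: "flow (\<lambda>w. \<Sum>j\<in>S. \<phi> j w * c j) w = (\<Sum>j\<in>S. flow (\<phi> j) w * c j)"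
proof -
  have *: "((\<Sum>j\<in>S. \<phi> j x * c j) - (\<Sum>j\<in>S. \<phi> j y * c j)) / l =
      (\<Sum>j\<in>S. (\<phi> j x - \<phi> j y) / l * c j)" for x y l
    by (simp add: sum_subtractf sum_divide_distrib left_diff_distrib diff_divide_distrib)
  show ?thesis
    unfolding flow_def * by (simp add: distrib_right sum_distrib_right sum.distrib
      sum.swap[of _ S])
qed

lemma flow_diff: "flow (\<lambda>w. f w - g w) w = flow f w - flow g w"
proof -
  have "(f x - g x - (f y - g y)) / l = (f x - f y) / l - (g x - g y) / l" for x y and l :: real
    by (simp add: diff_divide_distrib)
  then show ?thesis unfolding flow_def by (simp add: sum_subtractf)
qed

lemma flow_cmult: "flow (\<lambda>w. c * f w) w = c * flow f w"
  unfolding flow_def by (simp add: sum_distrib_left distrib_left right_diff_distrib)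

lemma flow_cong:
  assumes "w \<in> verts G" "\<And>x. x \<in> verts G \<Longrightarrow> f x = g x"
  shows "flow f w = flow g w"
  using assms unfolding flow_def
  by (intro arg_cong2[of _ _ _ _ "(+)"] sum.cong) auto

text \<open>Discrete Green formula: the contributions of an arc at its tail and at its head add up
  to the squared difference over the length.\<close>

lemma flow_energy:
  "(\<Sum>w\<in>verts G. f w * flow f w) = (\<Sum>e\<in>arcs G. (f (tail G e) - f (head G e))\<^sup>2 / len e)"
proof -
  let ?t = "\<lambda>e. f (tail G e)" and ?h = "\<lambda>e. f (head G e)"
  have "f w * flow f w = (\<Sum>e\<in>out_arcs G w. ?t e * (?t e - ?h e) / len e) +
      (\<Sum>e\<in>in_arcs G w. ?h e * (?h e - ?t e) / len e)" for w
    unfolding flow_def by (auto simp: distrib_left sum_distrib_left intro!: sum.cong)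
  then have "(\<Sum>w\<in>verts G. f w * flow f w) =
      (\<Sum>e\<in>arcs G. ?t e * (?t e - ?h e) / len e + ?h e * (?h e - ?t e) / len e)"
    by (simp only: sum.distrib sum_out_arcs sum_in_arcs)
  also have "\<dots> = (\<Sum>e\<in>arcs G. (?t e - ?h e)\<^sup>2 / len e)"
    by (intro sum.cong refl) (simp add: power2_eq_square algebra_simps flip: add_divide_distrib)
  finally show ?thesis .
qed

text \<open>At every vertex either \<open>f\<close> or its flow vanishes, so the energy is zero. Its
  summands are nonnegative, hence \<open>f\<close> is constant on arcs, thus globally, and zero at a
  Dirichlet vertex.\<close>

lemma dirichlet_problem_unique:
  assumes VD: "\<And>w. w \<in> VD \<Longrightarrow> f w = 0"
    and flow: "\<And>w. w \<in> verts G - VD \<Longrightarrow> flow f w = 0"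
    and w: "w \<in> verts G"
  shows "f w = 0"
proof -
  have "(\<Sum>w\<in>verts G. f w * flow f w) = 0"
    using VD flow by (intro sum.neutral) auto
  then have zero: "(\<Sum>e\<in>arcs G. (f (tail G e) - f (head G e))\<^sup>2 / len e) = 0"
    by (simp add: flow_energy)
  have "(f (tail G e) - f (head G e))\<^sup>2 / len e = 0" if "e \<in> arcs G" for e
    using zero len_pos that
    by (subst (asm) sum_nonneg_eq_0_iff) (auto intro!: divide_nonneg_pos)
  then have "f (tail G e) = f (head G e)" if "e \<in> arcs G" for e
    using that len_pos[OF that] by fastforce
  moreover obtain u where "u \<in> VD" using VD_nonempty by blast
  ultimately show ?thesis
    using const_if_const_on_arcs[of f w u] VD VD_verts w by auto
qed

text \<open>Existence follows from uniqueness, the unknowns being the finitely many values off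
  \<open>VD\<close>.\<close>

lemma dirichlet_problem_solvable:
  obtains f where "\<And>w. w \<in> VD \<Longrightarrow> f w = 0"
    and "\<And>w. w \<in> verts G - VD \<Longrightarrow> flow f w = b w"
proof -
  let ?S = "verts G - VD"
  \<comment> \<open>\<open>M\<close> is the matrix of \<open>flow\<close> in the basis of vertex
    indicators; the zero extension \<open>F\<close> builds in the Dirichlet condition.\<close>
  define M where "M i j = flow (\<lambda>w. if w = j then 1 else 0) i" for i j
  define F where "F x w = (if w \<in> ?S then x w else 0)" for x :: "'a \<Rightarrow> real" and w
  have fin: "finite ?S" by simp
  have "F x = (\<lambda>w. \<Sum>j\<in>?S. (if w = j then 1 else 0) * x j)" for x
    using fin by (intro ext) (simp add: F_def if_distrib[of "\<lambda>z. z * _"] cong: if_cong)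
  then have M: "flow (F x) w = (\<Sum>j\<in>?S. M w j * x j)" for x w
    unfolding M_def by (simp add: flow_sum)
  have inj: "\<forall>j\<in>?S. x j = 0" if x: "\<And>i. i \<in> ?S \<Longrightarrow> (\<Sum>j\<in>?S. M i j * x j) = 0" for x
  proof
    fix j assume j: "j \<in> ?S"
    have "F x j = 0"
    proof (rule dirichlet_problem_unique)
      show "F x w = 0" if "w \<in> VD" for w using that by (simp add: F_def)
      show "flow (F x) w = 0" if "w \<in> ?S" for w using x[OF that] M by simp
      show "j \<in> verts G" using j by simp
    qed
    then show "x j = 0" using j by (simp add: F_def)
  qed
  obtain x where "\<And>i. i \<in> ?S \<Longrightarrow> (\<Sum>j\<in>?S. M i j * x j) = b i"
    using linear_system_solvable[OF fin inj] by blast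
  then show ?thesis
    by (intro that[of "F x"]) (simp_all only: M, simp add: F_def)
qed

section \<open>The discrete Laplacian and its torsion function\<close>

text \<open>As \<open>w\<close> is not a Dirichlet vertex, an edge of \<open>E_D\<close> at
  \<open>w\<close> has its other end in \<open>VD\<close>, where the zero extension vanishes. Its
  contribution is \<open>f w / len e\<close>, which produces the potential.\<close>

lemma discrete_laplacian_eq_flow:
  assumes w: "w \<in> verts G - VD"
  shows "discrete_laplacian G len VD f w =
    flow (\<lambda>x. if x \<in> verts G - VD then f x else 0) w / vertex_weight G len w"
proof -
  let ?F = "\<lambda>x. if x \<in> verts G - VD then f x else 0"
  have split: "sum \<phi> A = sum \<phi> (A \<inter> E_N G VD) + sum \<phi> (A \<inter> E_D G VD)"
    if "finite A" "A \<subseteq> arcs G" for A and \<phi> :: "'b \<Rightarrow> real"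
  proof -
    have "A \<inter> E_D G VD = A - E_N G VD" using that(2) unfolding E_D_def by blast
    then show ?thesis using sum.Int_Diff[OF that(1)] by simp
  qed
  have outN: "(\<Sum>e\<in>out_arcs G w \<inter> E_N G VD. (?F w - ?F (head G e)) / len e) =
      (\<Sum>e\<in>out_arcs G w \<inter> E_N G VD. edge_weight len e * (f w - f (head G e)))"
    using w by (intro sum.cong) (auto simp: E_N_def edge_weight_def)
  have inN: "(\<Sum>e\<in>in_arcs G w \<inter> E_N G VD. (?F w - ?F (tail G e)) / len e) =
      (\<Sum>e\<in>in_arcs G w \<inter> E_N G VD. edge_weight len e * (f w - f (tail G e)))"
    using w by (intro sum.cong) (auto simp: E_N_def edge_weight_def)
  have outD: "(\<Sum>e\<in>out_arcs G w \<inter> E_D G VD. (?F w - ?F (head G e)) / len e) =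
      (\<Sum>e\<in>out_arcs G w \<inter> E_D G VD. 1 / len e) * f w"
    unfolding sum_distrib_right using w by (intro sum.cong) (auto simp: E_D_def E_N_def)
  have inD: "(\<Sum>e\<in>in_arcs G w \<inter> E_D G VD. (?F w - ?F (tail G e)) / len e) =
      (\<Sum>e\<in>in_arcs G w \<inter> E_D G VD. 1 / len e) * f w"
    unfolding sum_distrib_right using w by (intro sum.cong) (auto simp: E_D_def E_N_def)
  have "out_arcs G w \<subseteq> arcs G" "in_arcs G w \<subseteq> arcs G" by auto
  then have "flow ?F w =
      (\<Sum>e\<in>out_arcs G w \<inter> E_N G VD. edge_weight len e * (f w - f (head G e))) +
      (\<Sum>e\<in>in_arcs G w \<inter> E_N G VD. edge_weight len e * (f w - f (tail G e))) +
      potential G len VD w * f w"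
    unfolding flow_def potential_def distrib_right outN[symmetric] inN[symmetric]
      outD[symmetric] inD[symmetric]
    by (simp only: split[OF finite_out_arcs] split[OF finite_in_arcs] ac_simps)
  then show ?thesis
    using w unfolding discrete_laplacian_def by simp
qed

text \<open>The difference of the zero extensions solves the homogeneous Dirichlet problem.
  Injectivity makes \<open>inv_into\<close> a genuine inverse on the range.\<close>

lemma inj_on_discrete_laplacian:
  "inj_on (discrete_laplacian G len VD) (extensional (verts G - VD))"
proof (rule inj_onI)
  fix f g assume ext: "f \<in> extensional (verts G - VD)" "g \<in> extensional (verts G - VD)"
    and eq: "discrete_laplacian G len VD f = discrete_laplacian G len VD g"
  let ?F = "\<lambda>f x. if x \<in> verts G - VD then f x else 0"
  have zero: "?F f w - ?F g w = 0" if w: "w \<in> verts G" for w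
  proof (rule dirichlet_problem_unique[OF _ _ w])
    fix w assume w: "w \<in> verts G - VD"
    have "flow (?F f) w / vertex_weight G len w = flow (?F g) w / vertex_weight G len w"
      using discrete_laplacian_eq_flow[OF w, of f] discrete_laplacian_eq_flow[OF w, of g] eq by metis
    moreover have "a = b" if "a / c = b / c" "0 < c" for a b c :: real
      using that by simp
    ultimately have "flow (?F f) w = flow (?F g) w"
      using vertex_weight_pos[OF w] by blast
    then show "flow (\<lambda>w. ?F f w - ?F g w) w = 0"
      by (simp only: flow_diff)
  qed auto
  have "f w = g w" if "w \<in> verts G - VD" for w
    using that zero[of w] by simp
  with ext show "f = g" by (rule extensionalityI)
qed

lemma discrete_torsion_function_eq:
  assumes VD: "\<And>w. w \<in> VD \<Longrightarrow> f w = 0"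
    and flow: "\<And>w. w \<in> verts G - VD \<Longrightarrow> flow f w = vertex_weight G len w"
    and w: "w \<in> verts G - VD"
  shows "discrete_torsion_function G len VD w = f w"
proof -
  let ?S = "verts G - VD"
  let ?f = "restrict f ?S"
  have "discrete_laplacian G len VD ?f = (\<lambda>w\<in>?S. 1)"
  proof
    fix x
    show "discrete_laplacian G len VD ?f x = (\<lambda>w\<in>?S. 1) x"
    proof (cases "x \<in> ?S")
      case True
      have "flow (\<lambda>y. if y \<in> ?S then ?f y else 0) x = flow f x"
        using True VD by (intro flow_cong) auto
      then show ?thesis
        using True flow[OF True] vertex_weight_pos[OF True] by (simp add: discrete_laplacian_eq_flow)
    next
      \<comment> \<open>Off \<open>verts G - VD\<close> both sides are
        \<open>undefined\<close>.\<close>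
      case False
      then show ?thesis unfolding discrete_laplacian_def by (simp only: restrict_apply if_False)
    qed
  qed
  then have "discrete_torsion_function G len VD = ?f"
    unfolding discrete_torsion_function_def
    using inj_on_discrete_laplacian by (intro inv_into_f_eq) auto
  then show ?thesis using w by simp
qed

end

section \<open>The torsion function\<close>

text \<open>The linear interpolation of \<open>a\<close> and \<open>b\<close> plus
  \<open>x * (l - x) / 2\<close>, the torsion function of an interval with Dirichlet ends.\<close>

definition profile :: "real \<Rightarrow> real \<Rightarrow> real \<Rightarrow> real \<Rightarrow> real" where
  "profile a b l x = a + ((b - a) / l + l / 2) * x - x\<^sup>2 / 2"

lemma profile_ends: "profile a b l 0 = a" "l \<noteq> 0 \<Longrightarrow> profile a b l l = b"
  unfolding profile_def by (simp_all add: field_simps power2_eq_square)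

lemma profile_has_derivative:
  "(profile a b l has_real_derivative (b - a) / l + l / 2 - x) (at x within S)"
  unfolding profile_def by (auto intro!: derivative_eq_intros)

lemma continuous_profile: "continuous_on S (profile a b l)"
  unfolding profile_def by (auto intro!: continuous_intros)

lemma quadratic_eq_profile:
  assumes "l \<noteq> 0"
  shows "A + c * x - x\<^sup>2 / 2 = profile A (A + c * l - l\<^sup>2 / 2) l x"
  using assms unfolding profile_def by (simp add: field_simps power2_eq_square)

text \<open>The linear part contributes length times mean end value, the part
  \<open>x * (l - x) / 2\<close> contributes \<open>l ^ 3 / 12\<close>.\<close>

lemma integral_profile:
  assumes l: "0 < l"
  shows "(LINT x|lebesgue_on {0..l}. profile a b l x) = l * (a + b) / 2 + l ^ 3 / 12"
proof -
  define P where "P x = a * x + ((b - a) / l + l / 2) * x\<^sup>2 / 2 - x ^ 3 / 6" for x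
  have "(P has_real_derivative profile a b l x) (at x within S)" for x S
    unfolding P_def profile_def
    by (auto intro!: derivative_eq_intros simp: power2_eq_square)
  then have "(profile a b l has_integral P l - P 0) {0..l}"
    using l unfolding has_real_derivative_iff_has_vector_derivative
    by (intro fundamental_theorem_of_calculus) auto
  then have "integral {0..l} (profile a b l) = P l - P 0"
    by (rule integral_unique)
  also have "\<dots> = l * (a + b) / 2 + l ^ 3 / 12"
    using l unfolding P_def by (simp add: field_simps power2_eq_square power3_eq_cube)
  finally show ?thesis
    using lebesgue_integral_eq_integral[OF continuous_imp_integrable_real[OF continuous_profile]]
    by simp
qed

section \<open>Continuity in the quotient topology\<close>

lemma edge_point_ends:
  "edge_point G len e 0 = Vertex (tail G e)"
  "len e \<noteq> 0 \<Longrightarrow> edge_point G len e (len e) = Vertex (head G e)"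
  unfolding edge_point_def by auto

context metric_graph
begin

lemma edge_point_in_points:
  assumes "e \<in> arcs G" "x \<in> {0..len e}"
  shows "edge_point G len e x \<in> points G len"
  using assms unfolding edge_point_def points_def by auto

lemma topspace_graph_topology: "topspace (graph_topology G len) = points G len"
proof -
  have "openin (graph_topology G len) (points G len)"
    unfolding openin_graph_topology
  proof (intro conjI ballI)
    fix e assume "e \<in> arcs G"
    then have "{x \<in> {0..len e}. edge_point G len e x \<in> points G len} = {0..len e}"
      using edge_point_in_points by blast
    then show "openin (top_of_set {0..len e})
        {x \<in> {0..len e}. edge_point G len e x \<in> points G len}"
      by simp
  qed simp
  moreover have "topspace (graph_topology G len) \<subseteq> points G len"
    using openin_topspace[of "graph_topology G len"] unfolding openin_graph_topology by blast
  ultimately show ?thesis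
    by (meson openin_subset subset_antisym)
qed

text \<open>The topology is final for the edge parametrisations, so continuity is tested after
  composing with them. Agreement at shared vertices is automatic, as \<open>u\<close> is one
  function on points.\<close>

lemma continuous_map_graph_topology_iff:
  "continuous_map (graph_topology G len) euclideanreal u \<longleftrightarrow>
    (\<forall>e\<in>arcs G. continuous_on {0..len e} (on_edge G len u e))"
proof -
  have pre: "{x \<in> {0..len e}. edge_point G len e x \<in> {p \<in> points G len. u p \<in> U}} =
      {0..len e} \<inter> on_edge G len u e -` U" if "e \<in> arcs G" for e U
    using edge_point_in_points[OF that] unfolding on_edge_def by auto
  show ?thesis
    unfolding continuous_map_def topspace_graph_topology openin_graph_topology
      continuous_openin_preimage_eq
    using pre by auto
qed

end

section \<open>From the boundary value problem to vertex values\<close>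

context dirichlet_graph
begin

lemma normal_derivatives_profile:
  assumes e: "e \<in> arcs G"
    and u: "\<And>x. x \<in> {0..len e} \<Longrightarrow> on_edge G len u e x = profile a b (len e) x"
  shows "normal_derivative_tail G len u e = (a - b) / len e - len e / 2"
    and "normal_derivative_head G len u e = (b - a) / len e - len e / 2"
proof -
  have pos: "0 < len e" using len_pos e by simp
  have "(on_edge G len u e has_vector_derivative (b - a) / len e + len e / 2 - x)
      (at x within {0..len e})" if "x \<in> {0..len e}" for x
    using that u
    by (intro has_vector_derivative_transform[OF that _
        profile_has_derivative[unfolded has_real_derivative_iff_has_vector_derivative]]) auto
  \<comment> \<open>On a nondegenerate closed interval the derivative within the interval is unique,
    also at the ends.\<close>
  then have vd: "vector_derivative (on_edge G len u e) (at x within {0..len e}) =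
      (b - a) / len e + len e / 2 - x" if "x \<in> {0..len e}" for x
    using vector_derivative_within_closed_interval[OF pos that] that by blast
  show "normal_derivative_tail G len u e = (a - b) / len e - len e / 2"
    using vd[of 0] pos unfolding normal_derivative_tail_def by (simp add: field_simps)
  show "normal_derivative_head G len u e = (b - a) / len e - len e / 2"
    using vd[of "len e"] pos unfolding normal_derivative_head_def by (simp add: field_simps)
qed

text \<open>An explicit substitute for continuity and the weak differential equation together:
  vertex values determine \<open>u\<close> on all edges.\<close>

definition torsion_profile :: "(('a, 'b) point \<Rightarrow> real) \<Rightarrow> bool" where
  "torsion_profile u \<longleftrightarrow> (\<forall>e\<in>arcs G. \<forall>x\<in>{0..len e}. on_edge G len u e x =
     profile (u (Vertex (tail G e))) (u (Vertex (head G e))) (len e) x)"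

lemma torsion_profile_if_H2:
  assumes cont: "continuous_map (graph_topology G len) euclideanreal u"
    and H2: "\<And>e. e \<in> arcs G \<Longrightarrow> \<exists>h. H2_second_derivative (len e) (on_edge G len u e) h \<and>
        (AE x in lebesgue_on {0<..<len e}. - h x = 1)"
  shows "torsion_profile u"
  unfolding torsion_profile_def
proof (intro ballI)
  fix e x assume e: "e \<in> arcs G" and x: "x \<in> {0..len e}"
  have pos: "0 < len e" using len_pos e by simp
  have "continuous_on {0..len e} (on_edge G len u e)"
    using cont e unfolding continuous_map_graph_topology_iff by blast
  then obtain A c where
    Ac: "\<And>x. x \<in> {0..len e} \<Longrightarrow> on_edge G len u e x = A + c * x - x\<^sup>2 / 2"
    using H2_minus_one_imp_quadratic[OF pos] H2[OF e] by metis
  have "u (Vertex (tail G e)) = A"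
    using Ac[of 0] pos by (simp add: on_edge_def edge_point_ends)
  moreover have "u (Vertex (head G e)) = A + c * len e - (len e)\<^sup>2 / 2"
    using Ac[of "len e"] pos by (simp add: on_edge_def edge_point_ends)
  ultimately show "on_edge G len u e x =
      profile (u (Vertex (tail G e))) (u (Vertex (head G e))) (len e) x"
    using Ac[OF x] quadratic_eq_profile[of "len e" A c x] pos by simp
qed

text \<open>Each end of an arc at \<open>w\<close> contributes a difference quotient minus half the
  length; a loop enters both sums, as it does in \<open>flow\<close> and
  \<open>vertex_weight\<close>.\<close>

lemma kirchhoff_sum_eq:
  assumes "torsion_profile u"
  shows "(\<Sum>e\<in>out_arcs G w. normal_derivative_tail G len u e) +
      (\<Sum>e\<in>in_arcs G w. normal_derivative_head G len u e) =
    flow (\<lambda>x. u (Vertex x)) w - vertex_weight G len w / 2"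
proof -
  have nd: "normal_derivative_tail G len u e =
      (u (Vertex (tail G e)) - u (Vertex (head G e))) / len e - len e / 2"
    "normal_derivative_head G len u e =
      (u (Vertex (head G e)) - u (Vertex (tail G e))) / len e - len e / 2" if "e \<in> arcs G" for e
    using normal_derivatives_profile[OF that] assms that unfolding torsion_profile_def by blast+
  have "(\<Sum>e\<in>out_arcs G w. normal_derivative_tail G len u e) =
      (\<Sum>e\<in>out_arcs G w. (u (Vertex w) - u (Vertex (head G e))) / len e - len e / 2)"
    by (intro sum.cong) (auto simp: nd)
  moreover have "(\<Sum>e\<in>in_arcs G w. normal_derivative_head G len u e) =
      (\<Sum>e\<in>in_arcs G w. (u (Vertex w) - u (Vertex (tail G e))) / len e - len e / 2)"
    by (intro sum.cong) (auto simp: nd)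
  ultimately show ?thesis
    unfolding flow_def vertex_weight_def
    by (simp only: sum_subtractf sum_divide_distrib[symmetric]) (simp add: field_simps)
qed

lemma is_torsion_function_iff:
  "is_torsion_function G len VD u \<longleftrightarrow> u \<in> extensional (points G len) \<and> torsion_profile u \<and>
    (\<forall>w\<in>VD. u (Vertex w) = 0) \<and>
    (\<forall>w\<in>verts G - VD. flow (\<lambda>x. u (Vertex x)) w = vertex_weight G len w / 2)"
proof -
  have "continuous_map (graph_topology G len) euclideanreal u \<and>
     (\<forall>e\<in>arcs G. \<exists>h. H2_second_derivative (len e) (on_edge G len u e) h \<and>
        (AE x in lebesgue_on {0<..<len e}. - h x = 1)) \<longleftrightarrow> torsion_profile u" (is "?L \<longleftrightarrow> _")
  proof
    assume ?L
    then show "torsion_profile u" by (intro torsion_profile_if_H2) auto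
  next
    assume prof: "torsion_profile u"
    have "continuous_on {0..len e} (on_edge G len u e)" if "e \<in> arcs G" for e
    proof -
      have "continuous_on {0..len e} (on_edge G len u e) \<longleftrightarrow> continuous_on {0..len e}
          (profile (u (Vertex (tail G e))) (u (Vertex (head G e))) (len e))"
        using prof that unfolding torsion_profile_def by (intro continuous_on_cong) auto
      then show ?thesis using continuous_profile by blast
    qed
    moreover have "H2_second_derivative (len e) (on_edge G len u e) (\<lambda>x. - 1)" if "e \<in> arcs G" for e
      using prof that len_pos[OF that] unfolding torsion_profile_def profile_def
      by (intro H2_second_derivative_quadratic) blast+
    ultimately show ?L
      unfolding continuous_map_graph_topology_iff by (auto intro!: exI[of _ "\<lambda>x. - 1"])
  qed
  then show ?thesis
    unfolding is_torsion_function_def using kirchhoff_sum_eq by auto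
qed

lemma torsion_profile_inner:
  assumes "torsion_profile u" "e \<in> arcs G" "0 < x" "x < len e"
  shows "u (Inner e x) = profile (u (Vertex (tail G e))) (u (Vertex (head G e))) (len e) x"
proof -
  have "on_edge G len u e x = u (Inner e x)"
    using assms unfolding on_edge_def edge_point_def by simp
  then show ?thesis
    using assms unfolding torsion_profile_def by force
qed

text \<open>The difference of the vertex values solves the homogeneous Dirichlet problem; the
  profiles carry equality to the edges, extensionality to the rest.\<close>

lemma torsion_function_unique:
  assumes u: "is_torsion_function G len VD u" and v: "is_torsion_function G len VD v"
  shows "u = v"
proof -
  note u = u[unfolded is_torsion_function_iff] and v = v[unfolded is_torsion_function_iff]
  have vert: "u (Vertex w) = v (Vertex w)" if w: "w \<in> verts G" for w
  proof -
    have "u (Vertex w) - v (Vertex w) = 0"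
    proof (rule dirichlet_problem_unique[OF _ _ w])
      show "u (Vertex x) - v (Vertex x) = 0" if "x \<in> VD" for x
        using u v that by simp
      have "flow (\<lambda>x. u (Vertex x)) x = flow (\<lambda>x. v (Vertex x)) x" if "x \<in> verts G - VD" for x
        using u v that by metis
      then show "flow (\<lambda>x. u (Vertex x) - v (Vertex x)) x = 0" if "x \<in> verts G - VD" for x
        using that by (simp add: flow_diff)
    qed
    then show ?thesis by simp
  qed
  have "u p = v p" if p: "p \<in> points G len" for p
  proof (cases p)
    case (Vertex w)
    then show ?thesis using p vert unfolding points_def by auto
  next
    case (Inner e x)
    then have "e \<in> arcs G" "0 < x" "x < len e" using p unfolding points_def by auto
    then show ?thesis
      using torsion_profile_inner[of u e x] torsion_profile_inner[of v e x] u v vert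
      unfolding Inner by simp
  qed
  then show ?thesis using u v extensionalityI by blast
qed

text \<open>Solve the discrete problem with half the vertex weights as right-hand side and fill the
  edges with parabolas.\<close>

lemma torsion_function_exists: "\<exists>u. is_torsion_function G len VD u"
proof -
  obtain f where f: "\<And>w. w \<in> VD \<Longrightarrow> f w = 0"
    "\<And>w. w \<in> verts G - VD \<Longrightarrow> flow f w = vertex_weight G len w / 2"
    using dirichlet_problem_solvable[of "\<lambda>w. vertex_weight G len w / 2"] by blast
  define u where "u = restrict (case_point f
    (\<lambda>e x. profile (f (tail G e)) (f (head G e)) (len e) x)) (points G len)"
  have vert: "u (Vertex w) = f w" if "w \<in> verts G" for w
    using that unfolding u_def points_def by simp
  have "torsion_profile u"
    unfolding torsion_profile_def
  proof (intro ballI)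
    fix e x assume e: "e \<in> arcs G" and x: "x \<in> {0..len e}"
    \<comment> \<open>\<open>edge_point\<close> sends both ends of the interval to vertices, so they
      are treated apart from the interior.\<close>
    then consider "x = 0" | "x = len e" | "0 < x" "x < len e" by fastforce
    then show "on_edge G len u e x =
        profile (u (Vertex (tail G e))) (u (Vertex (head G e))) (len e) x"
    proof cases
      case 3
      then have "u (Inner e x) = profile (f (tail G e)) (f (head G e)) (len e) x"
        using e unfolding u_def points_def by auto
      with 3 e show ?thesis by (simp add: vert on_edge_def edge_point_def)
    qed (use len_pos[OF e] in \<open>simp_all add: on_edge_def edge_point_ends profile_ends\<close>)
  qed
  moreover have "flow (\<lambda>x. u (Vertex x)) w = flow f w" if "w \<in> verts G" for w
    using that vert by (intro flow_cong) auto
  moreover have "u \<in> extensional (points G len)"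
    unfolding u_def by simp
  ultimately have "is_torsion_function G len VD u"
    using f vert VD_verts unfolding is_torsion_function_iff by auto
  then show ?thesis by blast
qed

lemma is_torsion_function_torsion_function:
  "is_torsion_function G len VD (torsion_function G len VD)"
proof -
  have "\<exists>!u. is_torsion_function G len VD u"
    using torsion_function_exists torsion_function_unique by blast
  then show ?thesis
    unfolding torsion_function_def by (rule theI')
qed

text \<open>The factor 1/4 has two sources: one half from the mean of the end values in the edge
  integrals, another because vertex values are half the discrete torsion function.\<close>

lemma torsional_rigidity_eq:
  "torsional_rigidity G len VD =
    (\<Sum>e\<in>arcs G. len e ^ 3 / 12) + 1 / 4 * discrete_torsional_rigidity G len VD"
proof -
  define u where "u = torsion_function G len VD"
  define f where "f w = u (Vertex w)" for w
  have prof: "torsion_profile u"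
    and VD: "\<And>w. w \<in> VD \<Longrightarrow> f w = 0"
    and flow: "\<And>w. w \<in> verts G - VD \<Longrightarrow> flow f w = vertex_weight G len w / 2"
    using is_torsion_function_torsion_function
    unfolding is_torsion_function_iff u_def f_def by auto
  have disc: "discrete_torsion_function G len VD w = 2 * f w" if w: "w \<in> verts G - VD" for w
  proof (rule discrete_torsion_function_eq[OF _ _ w])
    show "2 * f w = 0" if "w \<in> VD" for w using VD[OF that] by simp
    show "flow (\<lambda>w. 2 * f w) w = vertex_weight G len w" if "w \<in> verts G - VD" for w
      using flow[OF that] by (simp add: flow_cmult)
  qed
  have "(LINT x|lebesgue_on {0..len e}. on_edge G len u e x) =
      len e * (f (tail G e) + f (head G e)) / 2 + len e ^ 3 / 12" if e: "e \<in> arcs G" for e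
  proof -
    have "(LINT x|lebesgue_on {0..len e}. on_edge G len u e x) =
        (LINT x|lebesgue_on {0..len e}. profile (f (tail G e)) (f (head G e)) (len e) x)"
      using prof e unfolding torsion_profile_def f_def
      by (intro Bochner_Integration.integral_cong) auto
    then show ?thesis using integral_profile[OF len_pos[OF e]] by simp
  qed
  then have "torsional_rigidity G len VD =
      (\<Sum>e\<in>arcs G. len e * f (tail G e) + len e * f (head G e)) / 2 + (\<Sum>e\<in>arcs G. len e ^ 3 / 12)"
    unfolding torsional_rigidity_def u_def[symmetric]
    by (simp add: sum.distrib distrib_left flip: sum_divide_distrib)
  also have "(\<Sum>e\<in>arcs G. len e * f (tail G e) + len e * f (head G e)) =
      (\<Sum>w\<in>verts G. (\<Sum>e\<in>out_arcs G w. len e * f (tail G e)) + (\<Sum>e\<in>in_arcs G w. len e * f (head G e)))"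
    by (simp only: sum.distrib sum_out_arcs sum_in_arcs)
  also have "\<dots> = (\<Sum>w\<in>verts G. vertex_weight G len w * f w)"
    unfolding vertex_weight_def distrib_right sum_distrib_right
    by (intro sum.cong arg_cong2[of _ _ _ _ "(+)"]) auto
  \<comment> \<open>Dirichlet vertices drop out because \<open>f\<close> vanishes there.\<close>
  also have "\<dots> = (\<Sum>w\<in>verts G - VD. vertex_weight G len w * f w)"
    using VD by (intro sum.mono_neutral_right) auto
  also have "\<dots> = discrete_torsional_rigidity G len VD / 2"
    unfolding discrete_torsional_rigidity_def sum_divide_distrib
    by (intro sum.cong) (auto simp: disc)
  finally show ?thesis by simp
qed

end

theorem theorem3p9:
  fixes G :: "('v, 'e) pre_digraph" and len :: "'e \<Rightarrow> real" and VD :: "'v set"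
  assumes "metric_graph G len"
    and "VD \<noteq> {}" and "VD \<subseteq> verts G"
  shows "torsional_rigidity G len VD =
    (\<Sum>e\<in>arcs G. (len e) ^ 3 / 12) + 1 / 4 * discrete_torsional_rigidity G len VD"
proof -
  interpret dirichlet_graph G len VD
    using assms by (intro dirichlet_graph.intro dirichlet_graph_axioms.intro)
  show ?thesis by (rule torsional_rigidity_eq)
qed

end
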